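(* Let $P \subseteq \mathbb{R}^2$ be a nonempty open set, and let $Q_P = P \cap \mathbb{Q}^2$ be the set of points of $P$ with both coordinates rational. Then $\operatorname{opx}(n, Q_P) = \Theta(n^2)$ (as $n \to \infty$ over positive reals), where the constant in the lower bound depends on $P$.
   Context: Containment for subsets of the plane: for $P, S \subseteq \mathbb{R}^2$, let $X_P, Y_P$ be the sets of $x$-coordinates and $y$-coordinates of points of $P$, and $X_S, Y_S$ likewise for $S$. $S$ contains $P$ if there exist functions $f_X: X_P \to X_S$ and $f_Y: Y_P \to Y_S$ such that (1) $\frac{f_X(x_0)-f_X(x_1)}{x_0-x_1} \ge 1$ for all $x_0 > x_1$ in $X_P$; (2) $\frac{f_Y(y_0)-f_Y(y_1)}{y_0-y_1} \ge 1$ for all $y_0 > y_1$ in $Y_P$; (3) $(f_X(x), f_Y(y)) \in S$ for all $(x,y) \in P$. Otherwise $S$ is $P$-free. For real $n > 0$, $\operatorname{opx}(n,P)$ is the supremum of the Lebesgue measure $\mu_2(S)$ over all open (in $\mathbb{R}^2$) $P$-free subsets $S \subseteq [0,n]^2$. $f(n) = \Theta(g(n))$ means there are constants $C_1, C_2 > 0$ with $C_1 g(n) \le f(n) \le C_2 g(n)$ for all sufficiently large $n$. *)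

theory Defs
  imports "HOL-Analysis.Analysis"
begin

definition expanding_on :: "real set \<Rightarrow> (real \<Rightarrow> real) \<Rightarrow> bool" where
  "expanding_on A f \<longleftrightarrow>
     (\<forall>a\<in>A. \<forall>b\<in>A. a > b \<longrightarrow> (f a - f b) / (a - b) \<ge> 1)"

text \<open>
  The maps are total functions on the reals, but only their values on the
  coordinate sets of P matter.
\<close>
definition contains_pattern :: "(real \<times> real) set \<Rightarrow> (real \<times> real) set \<Rightarrow> bool" where
  "contains_pattern S P \<longleftrightarrow>
     (\<exists>f\<^sub>X f\<^sub>Y. f\<^sub>X \<in> fst ` P \<rightarrow> fst ` S \<and> f\<^sub>Y \<in> snd ` P \<rightarrow> snd ` S \<and>
        expanding_on (fst ` P) f\<^sub>X \<and> expanding_on (snd ` P) f\<^sub>Y \<and>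
        (\<forall>(x, y)\<in>P. (f\<^sub>X x, f\<^sub>Y y) \<in> S))"

abbreviation pattern_free :: "(real \<times> real) set \<Rightarrow> (real \<times> real) set \<Rightarrow> bool" where
  "pattern_free P S \<equiv> \<not> contains_pattern S P"

text \<open>
  If P is nonempty, the empty set is P-free, and all the measures are at most
  \<open>n\<^sup>2\<close>, so the supremum is over a nonempty bounded set of reals. If P is empty,
  every set contains P and the value is the junk value \<open>Sup {}\<close>.
\<close>
definition opx :: "real \<Rightarrow> (real \<times> real) set \<Rightarrow> real" where
  "opx n P =
     Sup {measure lebesgue S | S. open S \<and> S \<subseteq> {0..n} \<times> {0..n} \<and> pattern_free P S}"

definition rational_points :: "(real \<times> real) set \<Rightarrow> (real \<times> real) set" where
  "rational_points P = P \<inter> (\<rat> \<times> \<rat>)"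

end

theory Submission
  imports Defs
begin

text \<open>
  Cut \<open>[0,n]\<^sup>2\<close> into \<open>N \<times> N\<close> congruent open cells with \<open>N = 4\<^sup>k\<close> and keep those where a
  Sylvester-Hadamard matrix has the entry 1; this is at least half of the area. An expanding map
  sends points at distance at least the cell width into different columns (or rows). As \<open>P\<close> contains
  a square with rational corners and rational side length \<open>l\<close>, a copy of its \<open>m \<times> m\<close> grid with spacing \<open>l / m \<ge> n / N\<close> yields an all-ones \<open>m \<times> m\<close> submatrix.
  By Lindsey's lemma \<open>m\<^sup>2 \<le> N\<close>, which fails for \<open>m = 2 \<surd>N\<close>, a choice that respects the
  spacing as soon as \<open>\<surd>N \<ge> 2 n / l\<close>.
\<close>

section \<open>Sylvester-Hadamard matrices and Lindsey's lemma\<close>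

fun sylvester :: "nat \<Rightarrow> nat \<Rightarrow> nat \<Rightarrow> real" where
  "sylvester 0 i j = 1"
| "sylvester (Suc k) i j =
     (if 2 ^ k \<le> i \<and> 2 ^ k \<le> j then -1 else 1) * sylvester k (i mod 2 ^ k) (j mod 2 ^ k)"

lemma sylvester_cases: "sylvester k i j = 1 \<or> sylvester k i j = -1"
  by (induction k arbitrary: i j) auto

lemma sum_lessThan_double:
  fixes f :: "nat \<Rightarrow> 'a :: comm_monoid_add"
  shows "(\<Sum>i<2 * m. f i) = (\<Sum>i<m. f i) + (\<Sum>i<m. f (m + i))"
  using sum.nat_group[of f m 2]
  by (simp add: mult.commute numeral_2_eq_2 lessThan_atLeast0 sum.atLeastLessThan_shift_0[of f m])

text \<open>This is orthogonality of the matrix, H^T H = 2^k I, as an identity of norms, the form in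
  which Lindsey's lemma uses it. Doubling has the block form [[H, H], [H, -H]], so on a vector split
  into halves x and y the blocks of the result are Hx + Hy and Hx - Hy.\<close>

lemma sylvester_norm:
  "(\<Sum>i<2 ^ k. (\<Sum>j<2 ^ k. sylvester k i j * x j)\<^sup>2) = 2 ^ k * (\<Sum>j<2 ^ k. (x j)\<^sup>2)"
proof (induction k arbitrary: x)
  case (Suc k)
  define y where "y = (\<lambda>j. x (2 ^ k + j))"
  define p where "p = (\<lambda>z i. \<Sum>j<2 ^ k. sylvester k i j * z j)"
  have top: "(\<Sum>j<2 ^ Suc k. sylvester (Suc k) i j * x j) = p x i + p y i"
    if "i < 2 ^ k" for i
    using that by (simp add: sum_lessThan_double p_def y_def)
  have bottom: "(\<Sum>j<2 ^ Suc k. sylvester (Suc k) (2 ^ k + i) j * x j) = p x i - p y i"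
    if "i < 2 ^ k" for i
    using that by (simp add: sum_lessThan_double p_def y_def sum_negf)
  have "(\<Sum>i<2 ^ Suc k. (\<Sum>j<2 ^ Suc k. sylvester (Suc k) i j * x j)\<^sup>2) =
      (\<Sum>i<2 ^ k. (p x i + p y i)\<^sup>2) + (\<Sum>i<2 ^ k. (p x i - p y i)\<^sup>2)"
    unfolding power_Suc[of 2 k] sum_lessThan_double[of _ "2 ^ k"]
    using top bottom by (simp add: sum_lessThan_double)
  \<comment> \<open>Parallelogram identity, row by row: the cross terms cancel.\<close>
  also have "\<dots> = 2 * (\<Sum>i<2 ^ k. (p x i)\<^sup>2) + 2 * (\<Sum>i<2 ^ k. (p y i)\<^sup>2)"
    unfolding sum_distrib_left sum.distrib[symmetric]
    by (intro sum.cong) (simp_all add: power2_sum power2_diff)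
  also have "\<dots> = 2 ^ Suc k * ((\<Sum>j<2 ^ k. (x j)\<^sup>2) + (\<Sum>j<2 ^ k. (y j)\<^sup>2))"
    using Suc.IH[of x] Suc.IH[of y] by (simp add: p_def algebra_simps)
  finally show ?case
    by (simp add: sum_lessThan_double y_def)
qed simp

text \<open>Apply the norm identity to the indicator vector of \<open>B\<close>. Each row in
  \<open>A\<close> contributes (card B)^2, the other rows contribute nonnegative squares, and the
  total is 2^k card B; cancelling card B leaves the bound.\<close>

lemma sylvester_lindsey:
  assumes "A \<subseteq> {..<2 ^ k}" "B \<subseteq> {..<2 ^ k}" and ones: "\<And>i j. i \<in> A \<Longrightarrow> j \<in> B \<Longrightarrow> sylvester k i j = 1"
  shows "card A * card B \<le> 2 ^ k"
proof (cases "card B = 0")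
  case False
  have row: "(\<Sum>j<2 ^ k. sylvester k i j * of_bool (j \<in> B)) = card B" if "i \<in> A" for i
  proof -
    have "(\<Sum>j<2 ^ k. sylvester k i j * of_bool (j \<in> B)) = (\<Sum>j\<in>B. sylvester k i j)"
      using assms(2) by (intro sum.mono_neutral_cong_right) auto
    then show ?thesis
      using ones[OF that] by simp
  qed
  have "real (card A) * (real (card B))\<^sup>2 = (\<Sum>i\<in>A. (\<Sum>j<2 ^ k. sylvester k i j * of_bool (j \<in> B))\<^sup>2)"
    using row by simp
  also have "\<dots> \<le> (\<Sum>i<2 ^ k. (\<Sum>j<2 ^ k. sylvester k i j * of_bool (j \<in> B))\<^sup>2)"
    using assms(1) by (intro sum_mono2) auto
  also have "\<dots> = 2 ^ k * (\<Sum>j<2 ^ k. (of_bool (j \<in> B))\<^sup>2)"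
    by (rule sylvester_norm)
  also have "(\<Sum>j<2 ^ k. (of_bool (j \<in> B))\<^sup>2 :: real) = (\<Sum>j\<in>B. 1)"
    using assms(2) by (intro sum.mono_neutral_cong_right) auto
  finally have "real (card A * card B) * card B \<le> 2 ^ k * card B"
    by (simp add: power2_eq_square mult_ac)
  then have "real (card A * card B) \<le> 2 ^ k"
    using False mult_le_cancel_right_pos[of "real (card B)"] by auto
  then show ?thesis
    by (metis of_nat_le_iff of_nat_numeral of_nat_power)
qed simp

text \<open>In the block form three blocks count positively and one negatively, so each doubling
  multiplies the sum by 2.\<close>

lemma sylvester_sum: "(\<Sum>i<2 ^ k. \<Sum>j<2 ^ k. sylvester k i j) = 2 ^ k"
proof (induction k)
  case (Suc k)
  then show ?case
    by (simp add: sum_lessThan_double sum.distrib sum_negf)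
qed simp

text \<open>For an entry h in {1, -1}, twice the indicator of h = 1 is 1 + h. Summing over all
  entries gives (2^k)^2 plus the positive total of the matrix.\<close>

lemma card_sylvester_ones:
  "real (2 ^ k) ^ 2 \<le> 2 * real (card {(i, j) \<in> {..<2 ^ k} \<times> {..<2 ^ k}. sylvester k i j = 1})"
    (is "_ \<le> 2 * real (card ?E)")
proof -
  let ?I = "{..<2 ^ k} \<times> {..<2 ^ k} :: (nat \<times> nat) set"
  have "2 * real (card ?E) = (\<Sum>(i, j)\<in>?I. 2 * of_bool (sylvester k i j = 1))"
    by (simp add: case_prod_unfold sum_distrib_left[symmetric] sum.If_cases of_bool_def
        Int_def mem_Times_iff)
  also have "\<dots> = (\<Sum>(i, j)\<in>?I. 1 + sylvester k i j)"
    using sylvester_cases[of k] by (intro sum.cong) fastforce+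
  also have "\<dots> = real (2 ^ k) ^ 2 + 2 ^ k"
    using sylvester_sum[of k]
    by (simp add: case_prod_unfold sum.distrib sum.cartesian_product power2_eq_square)
  finally show ?thesis by simp
qed

section \<open>Unions of grid cells and their area\<close>

definition grid_cell :: "real \<Rightarrow> nat \<Rightarrow> real set" where
  "grid_cell \<epsilon> i = {\<epsilon> * i<..<\<epsilon> * (i + 1)}"

text \<open>Open cells make the union open, as \<open>opx\<close> requires, and pairwise disjoint,
  so that areas add and a coordinate determines its index. Only the grid lines, of measure zero, are
  lost.\<close>

definition grid_set :: "real \<Rightarrow> (nat \<times> nat) set \<Rightarrow> (real \<times> real) set" where
  "grid_set \<epsilon> E = (\<Union>(i, j)\<in>E. grid_cell \<epsilon> i \<times> grid_cell \<epsilon> j)"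

lemma grid_cell_unique:
  assumes "\<epsilon> > 0" "x \<in> grid_cell \<epsilon> i" "x \<in> grid_cell \<epsilon> j"
  shows "i = j"
proof -
  have "\<epsilon> * i < \<epsilon> * (j + 1)" "\<epsilon> * j < \<epsilon> * (i + 1)"
    using assms(2,3) unfolding grid_cell_def by auto
  then have "real i < real j + 1" "real j < real i + 1"
    using assms(1) by simp_all
  then show ?thesis by linarith
qed

lemma grid_cell_diam:
  "x \<in> grid_cell \<epsilon> i \<Longrightarrow> y \<in> grid_cell \<epsilon> i \<Longrightarrow> x - y < \<epsilon>"
  by (auto simp: grid_cell_def algebra_simps)

lemma open_grid_set: "open (grid_set \<epsilon> E)"
  by (auto simp: grid_set_def grid_cell_def intro!: open_Times)

lemma grid_set_subset:
  assumes "\<epsilon> \<ge> 0" "E \<subseteq> {..<N} \<times> {..<N}"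
  shows "grid_set \<epsilon> E \<subseteq> {0..\<epsilon> * N} \<times> {0..\<epsilon> * N}"
proof -
  have "grid_cell \<epsilon> i \<subseteq> {0..\<epsilon> * N}" if "i < N" for i
  proof -
    have "\<epsilon> * (i + 1) \<le> \<epsilon> * N"
      using that assms(1) by (intro mult_left_mono) auto
    moreover have "0 \<le> \<epsilon> * i"
      using assms(1) by simp
    ultimately show ?thesis
      by (auto simp: grid_cell_def)
  qed
  then show ?thesis
    using assms(2) unfolding grid_set_def by fast
qed

lemma measure_real_box:
  fixes a b c d :: real
  assumes "a \<le> b" "c \<le> d"
  shows "measure lebesgue ({a<..<b} \<times> {c<..<d}) = (b - a) * (d - c)"
proof -
  have "{a<..<b} \<times> {c<..<d} = box (a, c) (b, d)"
    by (auto simp: box_def Basis_prod_def)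
  then show ?thesis
    using assms by (simp add: measure_lborel_box_eq Basis_prod_def prod.union_disjoint)
qed

lemma measure_grid_set:
  fixes \<epsilon> :: real
  assumes "finite E" "\<epsilon> > 0"
  shows "measure lebesgue (grid_set \<epsilon> E) = card E * \<epsilon>\<^sup>2"
proof -
  have cell: "measure lebesgue (grid_cell \<epsilon> i \<times> grid_cell \<epsilon> j) = \<epsilon>\<^sup>2" for i j
    using assms(2) unfolding grid_cell_def
    by (subst measure_real_box) (auto simp: algebra_simps power2_eq_square)
  have "grid_cell \<epsilon> i \<times> grid_cell \<epsilon> j \<in> lmeasurable" for i j
    unfolding grid_cell_def
    by (intro lmeasurable_open bounded_Times open_Times) auto
  moreover have "pairwise (\<lambda>p q. disjnt (grid_cell \<epsilon> (fst p) \<times> grid_cell \<epsilon> (snd p))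
      (grid_cell \<epsilon> (fst q) \<times> grid_cell \<epsilon> (snd q))) E"
    using grid_cell_unique[OF assms(2)] by (auto simp: pairwise_def disjnt_iff)
  ultimately have "measure lebesgue (grid_set \<epsilon> E) =
      (\<Sum>(i, j)\<in>E. measure lebesgue (grid_cell \<epsilon> i \<times> grid_cell \<epsilon> j))"
    unfolding grid_set_def case_prod_unfold using assms(1) by (intro measure_UNION')
  then show ?thesis
    by (simp add: cell)
qed

section \<open>Expanding maps and pattern-freeness\<close>

lemma expanding_on_grid_cells:
  assumes exp: "expanding_on T f" and T: "\<And>s. s < m \<Longrightarrow> a + real s * d \<in> T"
    and d: "\<epsilon> > 0" "d \<ge> \<epsilon>"
    and cells: "\<And>s. s < m \<Longrightarrow> f (a + real s * d) \<in> grid_cell \<epsilon> (g s)"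
  shows "card (g ` {..<m}) = m"
proof -
  \<comment> \<open>Two images in one open cell differ by less than \<epsilon>. But distinct indices
    differ by at least 1, so the arguments are at least d \<ge> \<epsilon> apart, and the expanding
    map does not shrink this gap.\<close>
  have less: "g s \<noteq> g t" if "s < t" "t < m" for s t :: nat
  proof
    assume "g s = g t"
    then have "f (a + t * d) - f (a + s * d) < \<epsilon>"
      using cells[of s] cells[of t] that grid_cell_diam by simp
    moreover have "real (t - s) * d \<ge> 1 * \<epsilon>"
      using that d by (intro mult_mono) auto
    then have gap: "(a + t * d) - (a + s * d) \<ge> \<epsilon>"
      using that by (simp add: of_nat_diff algebra_simps)
    moreover have "(f (a + t * d) - f (a + s * d)) / ((a + t * d) - (a + s * d)) \<ge> 1"
    proof -
      have "a + t * d \<in> T" "a + s * d \<in> T"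
        using T[of t] T[of s] that by auto
      then show ?thesis
        using exp gap d(1) unfolding expanding_on_def by force
    qed
    ultimately show False
      using d(1) by (simp add: le_divide_eq split: if_splits)
  qed
  have "inj_on g {..<m}"
    using less by (intro inj_onI) (metis lessThan_iff linorder_neqE_nat)
  then show ?thesis
    by (simp add: card_image)
qed

text \<open>The two maps act on separate coordinates, so a copy of the m by m grid occupies a full
  product of m column and m row indices inside \<open>E\<close>: an all-ones submatrix too large for
  Lindsey's lemma.\<close>

lemma pattern_free_grid_set:
  assumes pat: "\<And>s t. s < m \<Longrightarrow> t < m \<Longrightarrow> (a + real s * d, c + real t * d) \<in> Q"
    and d: "\<epsilon> > 0" "d \<ge> \<epsilon>" and m: "m * m > 2 ^ k"
    and E: "E = {(i, j) \<in> {..<2 ^ k} \<times> {..<2 ^ k}. sylvester k i j = 1}"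
  shows "pattern_free Q (grid_set \<epsilon> E)"
proof
  assume "contains_pattern (grid_set \<epsilon> E) Q"
  then obtain f h where exp: "expanding_on (fst ` Q) f" "expanding_on (snd ` Q) h"
    and S: "\<And>x y. (x, y) \<in> Q \<Longrightarrow> (f x, h y) \<in> grid_set \<epsilon> E"
    unfolding contains_pattern_def by blast
  have S': "\<exists>i j. (i, j) \<in> E \<and> f (a + s * d) \<in> grid_cell \<epsilon> i \<and> h (c + t * d) \<in> grid_cell \<epsilon> j"
    if "s < m" "t < m" for s t
    using S[OF pat[OF that]] unfolding grid_set_def by auto
  have "m > 0"
    using m by (cases m) auto
  \<comment> \<open>The indices in \<open>S'\<close> may depend on both \<open>s\<close> and
    \<open>t\<close>. Fixing the other index at 0 gives \<open>p\<close> and \<open>q\<close> of one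
    variable each; uniqueness of cells then identifies them with the indices of every pair.\<close>
  obtain p where p: "\<And>s. s < m \<Longrightarrow> f (a + real s * d) \<in> grid_cell \<epsilon> (p s)"
    using S'[OF _ \<open>m > 0\<close>] by metis
  obtain q where q: "\<And>t. t < m \<Longrightarrow> h (c + t * d) \<in> grid_cell \<epsilon> (q t)"
    using S'[OF \<open>m > 0\<close>] by metis
  have pq: "(p s, q t) \<in> E" if "s < m" "t < m" for s t
    using S'[OF that] p[OF that(1)] q[OF that(2)] grid_cell_unique[OF d(1)] by metis
  have "card (p ` {..<m}) = m"
    using pat \<open>m > 0\<close> by (intro expanding_on_grid_cells[OF exp(1) _ d p]) force+
  moreover have "card (q ` {..<m}) = m"
    using pat \<open>m > 0\<close> by (intro expanding_on_grid_cells[OF exp(2) _ d q]) force+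
  moreover have "card (p ` {..<m}) * card (q ` {..<m}) \<le> 2 ^ k"
    using pq \<open>m > 0\<close> unfolding E by (intro sylvester_lindsey) auto
  ultimately show False
    using m by simp
qed

section \<open>Rational squares and the bounds on \<open>opx\<close>\<close>

lemma open_contains_rational_square:
  assumes "open (P :: (real \<times> real) set)" "P \<noteq> {}"
  obtains a c l where "a \<in> \<rat>" "c \<in> \<rat>" "l \<in> \<rat>" "l > 0" "{a..a + l} \<times> {c..c + l} \<subseteq> P"
proof -
  obtain x y where "(x, y) \<in> P"
    using assms(2) by auto
  then obtain A B where AB: "open A" "open B" "x \<in> A" "y \<in> B" "A \<times> B \<subseteq> P"
    using assms(1) by (elim open_prod_elim) auto
  obtain e where e: "e > 0" "ball x e \<subseteq> A" "ball y e \<subseteq> B"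
  proof -
    obtain e1 e2 where "e1 > 0" "ball x e1 \<subseteq> A" "e2 > 0" "ball y e2 \<subseteq> B"
      using AB by (meson openE)
    then show thesis
      by (intro that[of "min e1 e2"]) auto
  qed
  \<comment> \<open>Corner and side are chosen rational so that equal subdivisions of the square
    have rational points. The corner offset and the side are each below e / 2, so the far corner's
    coordinates stay within e of x and y.\<close>
  obtain a where a: "a \<in> \<rat>" "x < a" "a < x + e / 2"
    using Rats_dense_in_real[of x "x + e / 2"] e(1) by auto
  obtain c where c: "c \<in> \<rat>" "y < c" "c < y + e / 2"
    using Rats_dense_in_real[of y "y + e / 2"] e(1) by auto
  obtain l where l: "l \<in> \<rat>" "0 < l" "l < e / 2"
    using Rats_dense_in_real[of 0 "e / 2"] e(1) by auto
  have "{a..a + l} \<subseteq> ball x e" "{c..c + l} \<subseteq> ball y e"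
    using a c l by (auto simp: dist_real_def)
  then have "{a..a + l} \<times> {c..c + l} \<subseteq> A \<times> B"
    using e(2,3) by (intro Sigma_mono) auto
  then show thesis
    using that[OF a(1) c(1) l(1,2)] AB(5) by (metis subset_trans)
qed

lemma measure_subset_square_le:
  assumes "open S" "S \<subseteq> {0..n} \<times> {0..n}" "n \<ge> 0"
  shows "measure lebesgue S \<le> n\<^sup>2"
proof -
  have *: "{0..n} \<times> {0..n} = cbox (0, 0) (n, n)"
    by (auto simp: cbox_Pair_eq)
  have "measure lebesgue S \<le> measure lebesgue (cbox (0 :: real, 0 :: real) (n, n))"
    using assms(1,2) unfolding * by (intro measure_mono_fmeasurable) (auto intro: lborelD)
  also have "\<dots> = n\<^sup>2"
    using assms(3) by (simp add: content_Pair power2_eq_square)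
  finally show ?thesis .
qed

theorem theorem4p5:
  shows "\<exists>C\<^sub>2>0. \<forall>P :: (real \<times> real) set. open P \<and> P \<noteq> {} \<longrightarrow>
           (\<exists>C\<^sub>1>0. \<forall>\<^sub>F n :: real in at_top.
              C\<^sub>1 * n\<^sup>2 \<le> opx n (rational_points P) \<and>
              opx n (rational_points P) \<le> C\<^sub>2 * n\<^sup>2)"
proof (rule exI[of _ 1], intro conjI allI impI)
  fix P :: "(real \<times> real) set"
  assume "open P \<and> P \<noteq> {}"
  then obtain a c l where P: "a \<in> \<rat>" "c \<in> \<rat>" "l \<in> \<rat>" "l > 0" "{a..a + l} \<times> {c..c + l} \<subseteq> P"
    using open_contains_rational_square by metis
  define Q where "Q = rational_points P"
  have "\<forall>\<^sub>F n in at_top. 1 / 2 * n\<^sup>2 \<le> opx n (rational_points P) \<and>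
          opx n (rational_points P) \<le> 1 * n\<^sup>2"
    \<comment> \<open>The bounds hold for every n > 0: \<open>P\<close> enters only through the side
      \<open>l\<close>, which determines how fine the grid has to be.\<close>
    using eventually_gt_at_top[of 0]
  proof eventually_elim
    case (elim n)
    let ?M = "{measure lebesgue S | S. open S \<and> S \<subseteq> {0..n} \<times> {0..n} \<and> pattern_free Q S}"
    have upper: "v \<le> n\<^sup>2" if "v \<in> ?M" for v
      using that measure_subset_square_le elim by auto
    \<comment> \<open>With \<epsilon> = n / 4^k and spacing l / m = l / (2 * 2^k), the condition l /
      m \<ge> \<epsilon> amounts to 2 n / l \<le> 2^k. The even exponent in \<open>N\<close> makes
      its square root 2^k an integer, and m = 2 * 2^k gives m^2 = 4 N > N.\<close>
    obtain k where k: "2 * n / l < 2 ^ k"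
      using real_arch_pow[of 2 "2 * n / l"] by auto
    define N where "N = (2 :: nat) ^ (2 * k)"
    define m where "m = (2 :: nat) * 2 ^ k"
    define \<epsilon> where "\<epsilon> = n / N"
    define E where "E = {(i, j) \<in> {..<N} \<times> {..<N}. sylvester (2 * k) i j = 1}"
    have eps: "\<epsilon> > 0"
      using elim by (simp add: \<epsilon>_def N_def)
    have free: "pattern_free Q (grid_set \<epsilon> E)"
    proof (rule pattern_free_grid_set)
      fix s t assume st: "s < m" "t < m"
      have grid: "b + real s * (l / m) \<in> {b..b + l} \<inter> \<rat>" if "s < m" "b \<in> \<rat>" for s b
      proof -
        have "real s * l \<le> real m * l"
          using that P(4) by (intro mult_right_mono) auto
        then have "real s * (l / m) \<le> l"
          using that by (simp add: field_simps)
        then show ?thesis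
          using that P(3,4) by auto
      qed
      show "(a + real s * (l / m), c + real t * (l / m)) \<in> Q"
        using grid[OF st(1) P(1)] grid[OF st(2) P(2)] P(5)
        unfolding Q_def rational_points_def by blast
    next
      show "l / m \<ge> \<epsilon>"
      proof -
        have "\<epsilon> = n / (2 ^ k * 2 ^ k)"
          by (simp add: \<epsilon>_def N_def mult_2 power_add)
        also have "\<dots> \<le> (2 ^ k * l / 2) / (2 ^ k * 2 ^ k)"
          using k P(4) by (intro divide_right_mono) (auto simp: field_simps)
        also have "\<dots> = l / m"
          by (simp add: m_def)
        finally show ?thesis .
      qed
      show "m * m > 2 ^ (2 * k)"
      proof -
        have "m * m = 4 * 2 ^ (2 * k)"
          by (simp add: m_def mult_2[of k] power_add)
        then show ?thesis by simp
      qed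
      show "E = {(i, j) \<in> {..<2 ^ (2 * k)} \<times> {..<2 ^ (2 * k)}. sylvester (2 * k) i j = 1}"
        unfolding E_def N_def ..
    qed (rule eps)
    have "finite E"
      by (rule finite_subset[of _ "{..<N} \<times> {..<N}"]) (auto simp: E_def)
    then have "measure lebesgue (grid_set \<epsilon> E) = card E * \<epsilon>\<^sup>2"
      using eps by (rule measure_grid_set)
    moreover have "1 / 2 * (real N)\<^sup>2 \<le> card E"
      using card_sylvester_ones[of "2 * k"] unfolding E_def N_def by simp
    then have "1 / 2 * (real N)\<^sup>2 * \<epsilon>\<^sup>2 \<le> card E * \<epsilon>\<^sup>2"
      by (intro mult_right_mono) auto
    moreover have "(real N)\<^sup>2 * \<epsilon>\<^sup>2 = n\<^sup>2"
      by (simp add: \<epsilon>_def N_def power_divide)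
    ultimately have large: "1 / 2 * n\<^sup>2 \<le> measure lebesgue (grid_set \<epsilon> E)"
      by simp
    have "grid_set \<epsilon> E \<subseteq> {0..n} \<times> {0..n}"
      using grid_set_subset[of \<epsilon> E N] eps by (auto simp: E_def \<epsilon>_def N_def)
    then have mem: "measure lebesgue (grid_set \<epsilon> E) \<in> ?M"
      using free open_grid_set by blast
    \<comment> \<open>A real \<open>Sup\<close> is informative only for bounded nonempty sets:
      \<open>upper\<close> gives boundedness, and \<open>mem\<close> gives nonemptiness for the
      estimate from above.\<close>
    have "bdd_above ?M"
      using upper by (rule bdd_aboveI)
    then have "measure lebesgue (grid_set \<epsilon> E) \<le> Sup ?M"
      using mem by (intro cSup_upper)
    moreover have "Sup ?M \<le> n\<^sup>2"
      using mem upper by (intro cSup_least) auto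
    ultimately show ?case
      using large unfolding opx_def Q_def by simp
  qed
  then show "\<exists>C\<^sub>1>0. \<forall>\<^sub>F n in at_top. C\<^sub>1 * n\<^sup>2 \<le> opx n (rational_points P) \<and>
          opx n (rational_points P) \<le> 1 * n\<^sup>2"
    by (intro exI[of _ "1 / 2"]) simp
qed simp

end
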